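(* Let $\alpha\in(0,1)\cup(1,2)$ and let $${}_{\mathcal H}\overline{\mathcal M}^{\alpha}_-f:=\begin{cases}{}_{\mathcal H}\mathcal I_-^{(1-\alpha)/2}f,&\alpha\in(0,1),\\ f, & \alpha=1,\\ {}_{\mathcal H}\mathcal D_-^{(\alpha-1)/2}f,&\alpha\in(1,2).\end{cases}$$ Then, for every $t\ge0$, ${}_{\mathcal H}\overline{\mathcal M}^{\alpha}_-1_{[0,t)}\in L_2(\mathbb R^+)$, and the following inverse representation holds: $$B(t)=C'_\alpha\int_0^\infty\big({}_{\mathcal H}\overline{\mathcal M}^{\alpha}_-1_{[0,t)}\big)(s)\,dB^{\mathcal H}_\alpha(s)\quad\text{almost surely},$$ where $C'_\alpha:=\sqrt{\Gamma(\alpha)}/\Gamma((\alpha+1)/2)$, $B^{\mathcal H}_\alpha$ is the Hadamard fractional Brownian motion and $B$ is the standard Brownian motion from which it is constructed.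
   Context: $\mathbb R^+=(0,\infty)$. For $\beta>0$ the right-sided Hadamard integral is $$({}_{\mathcal H}\mathcal I^\beta_-f)(t)=\frac1{\Gamma(\beta)}\int_t^\infty\Big(\log\frac zt\Big)^{\beta-1}\frac{f(z)}{z}\,dz,\qquad t>0,$$ and for $\beta\in(0,1)$ the right-sided Hadamard derivative is $({}_{\mathcal H}\mathcal D^\beta_-f)(t)=-t\frac{d}{dt}({}_{\mathcal H}\mathcal I^{1-\beta}_-f)(t)$ (understood for almost every $t>0$). With $K_\alpha=\Gamma((\alpha+1)/2)/\sqrt{\Gamma(\alpha)}$, set ${}_{\mathcal H}\mathcal M^\alpha_-=K_\alpha\,{}_{\mathcal H}\mathcal D^{(1-\alpha)/2}_-$ for $\alpha\in(0,1)$ and ${}_{\mathcal H}\mathcal M^\alpha_-=K_\alpha\,{}_{\mathcal H}\mathcal I^{(\alpha-1)/2}_-$ for $\alpha\in(1,2)$. Let $B=\{B(t)\}_{t\ge0}$ be a standard Brownian motion. The Hadamard fractional Brownian motion is $$B^{\mathcal H}_\alpha(t)=\int_{\mathbb R^+}({}_{\mathcal H}\mathcal M^\alpha_-1_{[0,t)})(s)\,dB(s)=\frac1{\sqrt{\Gamma(\alpha)}}\int_0^t\Big(\log\frac ts\Big)^{(\alpha-1)/2}dB(s),\qquad t\ge 0.$$ For $f\in L_{2,\alpha}(\mathbb R^+):=\{f:\ {}_{\mathcal H}\mathcal M^\alpha_-f\in L_2(\mathbb R^+)\}$, the Wiener integral with respect to $B^{\mathcal H}_\alpha$ is defined by $$\int_{\mathbb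 R^+}f(s)\,dB^{\mathcal H}_\alpha(s):=\int_{\mathbb R^+}({}_{\mathcal H}\mathcal M^\alpha_-f)(s)\,dB(s).$$ *)

theory Defs
  imports "HOL-Probability.Probability"
begin

section \<open>Right-sided Hadamard operators on the positive half-line\<close>

text \<open>
  Functions are Lebesgue measurable and only their values on \<open>{0<..}\<close> up to null sets matter.
  The integrals and derivatives below are total functions in Isabelle; the predicates
  \<open>hadamard_integral_defined\<close> and \<open>hadamard_deriv_defined\<close> say that they are meaningful
  almost everywhere.
\<close>

definition hadamard_integrable_at :: "real \<Rightarrow> (real \<Rightarrow> real) \<Rightarrow> real \<Rightarrow> bool" where
  "hadamard_integrable_at \<beta> f t \<longleftrightarrow>
     set_integrable lebesgue {t<..} (\<lambda>z. ln (z / t) powr (\<beta> - 1) * (f z / z))"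

definition hadamard_integral :: "real \<Rightarrow> (real \<Rightarrow> real) \<Rightarrow> real \<Rightarrow> real" where
  "hadamard_integral \<beta> f t =
     1 / Gamma \<beta> * (LINT z:{t<..}|lebesgue. ln (z / t) powr (\<beta> - 1) * (f z / z))"

definition hadamard_integral_defined :: "real \<Rightarrow> (real \<Rightarrow> real) \<Rightarrow> bool" where
  "hadamard_integral_defined \<beta> f \<longleftrightarrow>
     (AE t in lebesgue_on {0<..}. hadamard_integrable_at \<beta> f t)"

definition hadamard_deriv :: "real \<Rightarrow> (real \<Rightarrow> real) \<Rightarrow> real \<Rightarrow> real" where
  "hadamard_deriv \<beta> f t = - t * deriv (hadamard_integral (1 - \<beta>) f) t"

definition hadamard_deriv_defined :: "real \<Rightarrow> (real \<Rightarrow> real) \<Rightarrow> bool" where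
  "hadamard_deriv_defined \<beta> f \<longleftrightarrow>
     (AE t in lebesgue_on {0<..}.
        (\<forall>\<^sub>F u in nhds t. hadamard_integrable_at (1 - \<beta>) f u) \<and>
        hadamard_integral (1 - \<beta>) f differentiable at t)"

definition hadamard_K :: "real \<Rightarrow> real" where
  "hadamard_K \<alpha> = Gamma ((\<alpha> + 1) / 2) / sqrt (Gamma \<alpha>)"

text \<open>
  The parameter \<open>\<alpha>\<close> ranges over \<open>{0<..<2}\<close>. For \<open>\<alpha> = 1\<close> the operator is the identity, which is
  consistent with \<open>hadamard_K 1 = 1\<close>.
\<close>

definition hadamard_M :: "real \<Rightarrow> (real \<Rightarrow> real) \<Rightarrow> real \<Rightarrow> real" where
  "hadamard_M \<alpha> f =
     (if \<alpha> < 1 then (\<lambda>s. hadamard_K \<alpha> * hadamard_deriv ((1 - \<alpha>) / 2) f s)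
      else if \<alpha> = 1 then f
      else (\<lambda>s. hadamard_K \<alpha> * hadamard_integral ((\<alpha> - 1) / 2) f s))"

definition hadamard_M_defined :: "real \<Rightarrow> (real \<Rightarrow> real) \<Rightarrow> bool" where
  "hadamard_M_defined \<alpha> f \<longleftrightarrow>
     (if \<alpha> < 1 then hadamard_deriv_defined ((1 - \<alpha>) / 2) f
      else if \<alpha> = 1 then True
      else hadamard_integral_defined ((\<alpha> - 1) / 2) f)"

definition hadamard_Mbar :: "real \<Rightarrow> (real \<Rightarrow> real) \<Rightarrow> real \<Rightarrow> real" where
  "hadamard_Mbar \<alpha> f =
     (if \<alpha> < 1 then hadamard_integral ((1 - \<alpha>) / 2) f
      else if \<alpha> = 1 then f
      else hadamard_deriv ((\<alpha> - 1) / 2) f)"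

definition hadamard_Mbar_defined :: "real \<Rightarrow> (real \<Rightarrow> real) \<Rightarrow> bool" where
  "hadamard_Mbar_defined \<alpha> f \<longleftrightarrow>
     (if \<alpha> < 1 then hadamard_integral_defined ((1 - \<alpha>) / 2) f
      else if \<alpha> = 1 then True
      else hadamard_deriv_defined ((\<alpha> - 1) / 2) f)"


section \<open>Square-integrable functions\<close>

definition square_integrable :: "'a measure \<Rightarrow> ('a \<Rightarrow> real) \<Rightarrow> bool" where
  "square_integrable M f \<longleftrightarrow> f \<in> borel_measurable M \<and> integrable M (\<lambda>x. (f x)\<^sup>2)"

definition L2_pos :: "(real \<Rightarrow> real) set" where
  "L2_pos = {f. square_integrable (lebesgue_on {0<..}) f}"

definition L2_hadamard :: "real \<Rightarrow> (real \<Rightarrow> real) set" where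
  "L2_hadamard \<alpha> = {f. hadamard_M_defined \<alpha> f \<and> hadamard_M \<alpha> f \<in> L2_pos}"


section \<open>Brownian motion and the Wiener integral\<close>

text \<open>Only times \<open>t \<ge> 0\<close> are relevant; values of \<open>B\<close> at negative times are unconstrained.\<close>

locale standard_brownian_motion = prob_space M
  for M :: "'a measure" and B :: "real \<Rightarrow> 'a \<Rightarrow> real" +
  assumes measurable_at: "\<And>t. 0 \<le> t \<Longrightarrow> B t \<in> borel_measurable M"
    and starts_at_0: "AE \<omega> in M. B 0 \<omega> = 0"
    and indep_increments:
      "\<And>(n::nat) \<tau>. 0 \<le> \<tau> 0 \<Longrightarrow> (\<And>i. i < n \<Longrightarrow> \<tau> i < \<tau> (Suc i)) \<Longrightarrow>
         indep_vars (\<lambda>_. borel) (\<lambda>i \<omega>. B (\<tau> (Suc i)) \<omega> - B (\<tau> i) \<omega>) {..<n}"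
    and normal_increments:
      "\<And>s t. 0 \<le> s \<Longrightarrow> s < t \<Longrightarrow>
         distributed M lborel (\<lambda>\<omega>. B t \<omega> - B s \<omega>) (normal_density 0 (sqrt (t - s)))"
    and continuous_paths: "AE \<omega> in M. continuous_on {0..} (\<lambda>t. B t \<omega>)"

text \<open>
  A list of triples \<open>(a, u, v)\<close> represents the step function \<open>\<Sum> a * 1\<^bsub>[u,v)\<^esub>\<close>; the
  intervals need not be disjoint.
\<close>

definition valid_step :: "(real \<times> real \<times> real) list \<Rightarrow> bool" where
  "valid_step xs \<longleftrightarrow> (\<forall>(a, u, v) \<in> set xs. 0 \<le> u \<and> u \<le> v)"

definition step_fun :: "(real \<times> real \<times> real) list \<Rightarrow> real \<Rightarrow> real" where
  "step_fun xs s = (\<Sum>(a, u, v)\<leftarrow>xs. a * indicator {u..<v} s)"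

definition step_integral ::
    "(real \<Rightarrow> 'a \<Rightarrow> real) \<Rightarrow> (real \<times> real \<times> real) list \<Rightarrow> 'a \<Rightarrow> real" where
  "step_integral B xs \<omega> = (\<Sum>(a, u, v)\<leftarrow>xs. a * (B v \<omega> - B u \<omega>))"

text \<open>\<open>X\<close> is a version of \<open>\<integral> f dB\<close>: the \<open>L\<^sub>2\<close>-limit of integrals of approximating step functions.\<close>

definition has_wiener_integral ::
    "'a measure \<Rightarrow> (real \<Rightarrow> 'a \<Rightarrow> real) \<Rightarrow> (real \<Rightarrow> real) \<Rightarrow> ('a \<Rightarrow> real) \<Rightarrow> bool" where
  "has_wiener_integral M B f X \<longleftrightarrow>
     f \<in> L2_pos \<and> square_integrable M X \<and>
     (\<exists>\<phi>. (\<forall>n. valid_step (\<phi> n)) \<and>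
       (\<lambda>n. LINT s|lebesgue_on {0<..}. (step_fun (\<phi> n) s - f s)\<^sup>2) \<longlonglongrightarrow> 0 \<and>
       (\<lambda>n. LINT \<omega>|M. (step_integral B (\<phi> n) \<omega> - X \<omega>)\<^sup>2) \<longlonglongrightarrow> 0)"

text \<open>An arbitrary version is chosen; for Brownian motion it is determined up to null events.\<close>

definition wiener_integral ::
    "'a measure \<Rightarrow> (real \<Rightarrow> 'a \<Rightarrow> real) \<Rightarrow> (real \<Rightarrow> real) \<Rightarrow> 'a \<Rightarrow> real" where
  "wiener_integral M B f = (SOME X. has_wiener_integral M B f X)"


section \<open>Hadamard fractional Brownian motion\<close>

definition hadamard_fbm ::
    "'a measure \<Rightarrow> (real \<Rightarrow> 'a \<Rightarrow> real) \<Rightarrow> real \<Rightarrow> real \<Rightarrow> 'a \<Rightarrow> real" where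
  "hadamard_fbm M B \<alpha> t = wiener_integral M B (hadamard_M \<alpha> (indicator {0..<t}))"

text \<open>
  \<open>\<integral> f dB\<^sup>H\<close> for the Hadamard fractional Brownian motion \<open>B\<^sup>H = hadamard_fbm M B \<alpha>\<close> driven by
  \<open>B\<close>, meaningful for \<open>f \<in> L2_hadamard \<alpha>\<close>.
\<close>

definition hadamard_fbm_integral ::
    "'a measure \<Rightarrow> (real \<Rightarrow> 'a \<Rightarrow> real) \<Rightarrow> real \<Rightarrow> (real \<Rightarrow> real) \<Rightarrow> 'a \<Rightarrow> real" where
  "hadamard_fbm_integral M B \<alpha> f = wiener_integral M B (hadamard_M \<alpha> f)"

lemma hadamard_fbm_integral_indicator:
  "hadamard_fbm_integral M B \<alpha> (indicator {0..<t}) = hadamard_fbm M B \<alpha> t"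
  by (simp add: hadamard_fbm_integral_def hadamard_fbm_def)

end

theory Submission
  imports Defs
begin

text \<open>
  Substituting \<open>z = t exp (- x)\<close> turns the right-sided Hadamard operators of functions supported
  in \<open>(0, t)\<close> into Riemann-Liouville operators, under which normalised powers form a convolution
  semigroup. Accordingly, with
  \<open>P\<^sub>q(z) = ln (t / z) powr (q - 1) / Gamma q\<close> on \<open>(0, t)\<close> and \<open>0\<close> elsewhere, one has
  \<open>I\<^sup>p P\<^sub>q = P\<^bsub>p + q\<^esub>\<close> by the Beta integral (\<open>hadamard_integral_log_power\<close>) and
  \<open>D\<^sup>b P\<^sub>q = P\<^bsub>q - b\<^esub>\<close> for \<open>b < q\<close> by differentiating \<open>P\<^bsub>q - b + 1\<^esub>\<close>
  (\<open>hadamard_deriv_log_power\<close>). On the positive half-line the indicator of \<open>[0, t)\<close> is \<open>P\<^sub>1\<close>.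
  Its image under the inverse operator is \<open>P\<^bsub>1 + b\<^esub>\<close> with \<open>b = (1 - \<alpha>) / 2\<close> in both ranges
  of \<open>\<alpha>\<close>, for \<open>\<alpha> > 1\<close> up to the single point \<open>t\<close>. By the Gamma integral, \<open>P\<^sub>q\<close> is square integrable
  when \<open>2 q - 1 > 0\<close>, and \<open>2 (1 + b) - 1 = 2 - \<alpha> > 0\<close>, so this image lies in \<open>L\<^sub>2\<close>; applying the operator itself leads back to \<open>K P\<^sub>1\<close>, with \<open>K\<close> the constant
  \<open>hadamard_K \<alpha>\<close> (\<open>hadamard_M_Mbar_indicator\<close>).

  What remains is that the Wiener integral of a function equal almost everywhere to the step function
  \<open>K 1\<^bsub>[0, t)\<^esub>\<close> is \<open>K (B t - B 0)\<close>. The Wiener integral is an arbitrary \<open>L\<^sub>2\<close>-limit of integrals of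
  approximating step functions, so the point is that this limit is almost surely unique
  (\<open>has_wiener_integral_unique\<close>). That follows from the isometry for step functions
  (\<open>step_isometry\<close>), which rests on the covariance \<open>min s t\<close> of Brownian motion.
\<close>

section \<open>Hadamard operators on powers of the logarithm\<close>

definition log_power :: "real \<Rightarrow> real \<Rightarrow> real \<Rightarrow> real" where
  "log_power t q z = (if 0 < z \<and> z < t then ln (t / z) powr (q - 1) / Gamma q else 0)"

text \<open>
  The substitution \<open>z = s (t / s) powr x\<close> turns this into the Beta integral over \<open>(0, 1)\<close>:
  then \<open>ln (z / s) = L x\<close> and \<open>ln (t / z) = L (1 - x)\<close> for \<open>L = ln (t / s)\<close>, while \<open>dz / z = L dx\<close>.
\<close>

lemma has_absolute_integral_log_Beta:
  fixes s t p q :: real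
  assumes "0 < s" "s < t" "0 < p" "0 < q"
  shows "(\<lambda>z. ln (z / s) powr (p - 1) * (ln (t / z) powr (q - 1) / z))
           absolutely_integrable_on {s<..<t} \<and>
         integral {s<..<t} (\<lambda>z. ln (z / s) powr (p - 1) * (ln (t / z) powr (q - 1) / z)) =
           Beta p q * ln (t / s) powr (p + q - 1)"
    (is "?f absolutely_integrable_on _ \<and> _")
proof -
  define L where "L = ln (t / s)"
  define g where "g = (\<lambda>x. s * exp (L * x))"
  have L: "L > 0" using assms by (simp add: L_def)
  have expL: "s * exp L = t" using assms by (simp add: L_def)
  have deriv: "(g has_field_derivative L * g x) (at x within {0<..<1})" for x
    unfolding g_def by (auto intro!: derivative_eq_intros)
  have gpos: "g x > 0" for x using assms by (simp add: g_def)
  have inj: "inj_on g {0<..<1}"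
    using assms L by (auto simp: inj_on_def g_def)
  have img: "g ` {0<..<1} = {s<..<t}"
  proof (intro set_eqI iffI)
    fix z assume "z \<in> g ` {0<..<1}"
    then obtain x where x: "0 < x" "x < 1" "z = s * exp (L * x)" by (auto simp: g_def)
    have "exp (L * x) < exp L" "1 < exp (L * x)" using L x by auto
    then show "z \<in> {s<..<t}"
      using assms(1) x(3) expL mult_strict_left_mono[of "exp (L * x)" "exp L" s]
        mult_strict_left_mono[of 1 "exp (L * x)" s] by auto
  next
    fix z assume z: "z \<in> {s<..<t}"
    have "ln (z / s) / L \<in> {0<..<1}"
      using z assms L by (auto simp: field_simps L_def ln_div)
    moreover have "g (ln (z / s) / L) = z" using z assms L by (simp add: g_def)
    ultimately show "z \<in> g ` {0<..<1}" by (metis imageI)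
  qed
  have integrand: "\<bar>L * g x\<bar> * ?f (g x) = L powr (p + q - 1) * (x powr (p - 1) * (1 - x) powr (q - 1))"
    if "x \<in> {0<..<1}" for x
  proof -
    have 1: "ln (g x / s) = L * x" using assms by (simp add: g_def)
    have "t / g x = exp (L * (1 - x))"
      using assms unfolding expL[symmetric] g_def by (simp add: field_simps exp_diff exp_add[symmetric])
    then have 2: "ln (t / g x) = L * (1 - x)" by simp
    have 3: "L powr (p + q - 1) = L * L powr (p - 1) * L powr (q - 1)"
      using L by (simp add: powr_diff powr_add)
    show ?thesis unfolding 1 2 3 using gpos[of x] L that by (simp add: powr_mult abs_mult)
  qed
  have "((\<lambda>x. L powr (p + q - 1) * (x powr (p - 1) * (1 - x) powr (q - 1))) has_integral
          L powr (p + q - 1) * Beta p q) {0<..<1}"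
    using has_integral_Beta_real[of p q] assms
    by (intro has_integral_mult_right) (simp add: has_integral_Icc_iff_Ioo)
  then have I: "((\<lambda>x. \<bar>L * g x\<bar> * ?f (g x)) has_integral L powr (p + q - 1) * Beta p q) {0<..<1}"
    by (rule has_integral_eq[rotated]) (use integrand in auto)
  have "(\<lambda>x. \<bar>L * g x\<bar> * ?f (g x)) absolutely_integrable_on {0<..<1}"
  proof (rule nonnegative_absolutely_integrable_1)
    show "(\<lambda>x. \<bar>L * g x\<bar> * ?f (g x)) integrable_on {0<..<1}" using I by blast
  next
    fix x :: real assume "x \<in> {0<..<1}"
    then show "0 \<le> \<bar>L * g x\<bar> * ?f (g x)" using gpos[of x] by simp
  qed
  with I have "(\<lambda>x. \<bar>L * g x\<bar> * ?f (g x)) absolutely_integrable_on {0<..<1} \<and>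
     integral {0<..<1} (\<lambda>x. \<bar>L * g x\<bar> * ?f (g x)) = L powr (p + q - 1) * Beta p q"
    by (simp add: integral_unique)
  then have "?f absolutely_integrable_on g ` {0<..<1} \<and>
     integral (g ` {0<..<1}) ?f = L powr (p + q - 1) * Beta p q"
    by (subst has_absolute_integral_change_of_variables_1'[OF _ deriv inj, symmetric]) simp_all
  then show ?thesis
    unfolding img L_def by (simp only: mult.commute simp_thms)
qed

text \<open>
  Hadamard derivatives take an unspecified value at the end point \<open>t\<close>, so functions are compared
  off one exceptional point. Changing a function there affects neither integrability nor the integral.
\<close>

lemma hadamard_integral_cong_off_point:
  assumes "0 < s" and eq: "\<And>z. 0 < z \<Longrightarrow> z \<noteq> c \<Longrightarrow> f z = g z"
  shows "hadamard_integrable_at p f s \<longleftrightarrow> hadamard_integrable_at p g s"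
    and "hadamard_integral p f s = hadamard_integral p g s"
proof -
  let ?F = "\<lambda>f z. indicator {s<..} z *\<^sub>R (ln (z / s) powr (p - 1) * (f z / z))"
  have *: "?F f z = ?F g z" if "z \<notin> {c}" for z
    using assms that by (simp add: indicator_def)
  show "hadamard_integrable_at p f s \<longleftrightarrow> hadamard_integrable_at p g s"
    unfolding hadamard_integrable_at_def set_integrable_def
    by (rule integrable_discrete_difference[where X = "{c}"]) (use * in auto)
  have "integral\<^sup>L lebesgue (?F f) = integral\<^sup>L lebesgue (?F g)"
    by (rule integral_discrete_difference[where X = "{c}"]) (use * in auto)
  then show "hadamard_integral p f s = hadamard_integral p g s"
    by (simp only: hadamard_integral_def set_lebesgue_integral_def)
qed

text \<open>
  The Beta integral has value \<open>Gamma p * Gamma q / Gamma (p + q)\<close>; the normalisations of the integral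
  operator and of \<open>log_power\<close> cancel the numerator and leave that of exponent \<open>p + q\<close>.
\<close>

lemma hadamard_integral_log_power:
  assumes "0 < p" "0 < q" "0 < s"
    and f: "\<And>z. 0 < z \<Longrightarrow> z \<noteq> t \<Longrightarrow> f z = log_power t q z"
  shows "hadamard_integrable_at p f s"
    and "hadamard_integral p f s = log_power t (p + q) s"
proof -
  let ?h = "\<lambda>z. ln (z / s) powr (p - 1) * (log_power t q z / z)"
  let ?f = "\<lambda>z. ln (z / s) powr (p - 1) * (ln (t / z) powr (q - 1) / z)"
  have eq: "indicator {s<..} z *\<^sub>R ?h z = (1 / Gamma q) * (indicator {s<..<t} z *\<^sub>R ?f z)" for z
    using assms by (auto simp: log_power_def indicator_def)
  have "hadamard_integrable_at p (log_power t q) s \<and>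
        hadamard_integral p (log_power t q) s = log_power t (p + q) s"
  proof (cases "s < t")
    case True
    note B = has_absolute_integral_log_Beta[OF assms(3) True assms(1,2)]
    from B have int: "set_integrable lebesgue {s<..<t} ?f" by simp
    have "hadamard_integrable_at p (log_power t q) s"
      using int unfolding hadamard_integrable_at_def set_integrable_def eq
      by (intro integrable_mult_right)
    moreover have "(LINT z:{s<..}|lebesgue. ?h z) = 1 / Gamma q * (LINT z:{s<..<t}|lebesgue. ?f z)"
      unfolding set_lebesgue_integral_def eq by (rule integral_mult_right_zero)
    then have "(LINT z:{s<..}|lebesgue. ?h z) = Beta p q * ln (t / s) powr (p + q - 1) / Gamma q"
      using B set_lebesgue_integral_eq_integral(2)[OF int] by simp
    then have "hadamard_integral p (log_power t q) s = log_power t (p + q) s"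
      using True assms(3) Gamma_real_pos[OF assms(1), THEN less_imp_neq]
        Gamma_real_pos[OF assms(2), THEN less_imp_neq]
      by (simp add: hadamard_integral_def log_power_def Beta_def)
    ultimately show ?thesis by simp
  next
    case False
    then have "{s<..<t} = {}" by auto
    then show ?thesis
      using False unfolding hadamard_integrable_at_def hadamard_integral_def
        set_integrable_def set_lebesgue_integral_def eq
      by (simp add: log_power_def)
  qed
  then show "hadamard_integrable_at p f s"
    and "hadamard_integral p f s = log_power t (p + q) s"
    using hadamard_integral_cong_off_point[OF assms(3) f] by auto
qed

lemma DERIV_log_power:
  assumes "0 < s" "s \<noteq> t" "0 < q"
  shows "(log_power t (q + 1) has_real_derivative - log_power t q s / s) (at s)"
proof (cases "s < t")
  case True
  have l: "ln (t / s) > 0" using assms True by simp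
  have "((\<lambda>z. ln (t / z)) has_real_derivative - 1 / s) (at s)"
    using assms True by (auto intro!: derivative_eq_intros simp: field_simps power2_eq_square)
  from DERIV_fun_powr[OF this l, of q]
  have "((\<lambda>z. ln (t / z) powr q / Gamma (q + 1)) has_real_derivative
      q * ln (t / s) powr (q - 1) * (- 1 / s) / Gamma (q + 1)) (at s)"
    by (intro DERIV_cdivide) simp
  also have "q * ln (t / s) powr (q - 1) * (- 1 / s) / Gamma (q + 1) = - log_power t q s / s"
    using assms True Gamma_real_pos[of q] nonpos_Ints_nonpos[of q]
    by (subst Gamma_plus1) (auto simp: log_power_def)
  finally have "((\<lambda>z. ln (t / z) powr q / Gamma (q + 1)) has_real_derivative
      - log_power t q s / s) (at s)" .
  moreover have "\<forall>\<^sub>F z in nhds s. z \<in> {0<..<t}"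
    using assms True by (intro eventually_nhds_in_open) auto
  ultimately show ?thesis
    by (subst DERIV_cong_ev[OF refl _ refl]) (auto elim!: eventually_mono simp: log_power_def)
next
  case False
  have "\<forall>\<^sub>F z in nhds s. z \<in> {t<..}"
    using assms False by (intro eventually_nhds_in_open) auto
  then have "\<forall>\<^sub>F z in nhds s. log_power t (q + 1) z = 0"
    by eventually_elim (simp add: log_power_def)
  moreover have "((\<lambda>z. 0) has_real_derivative - log_power t q s / s) (at s)"
    using False by (simp add: log_power_def)
  ultimately show ?thesis
    by (subst DERIV_cong_ev[OF refl _ refl]) auto
qed

text \<open>
  The integral of order \<open>1 - b\<close> raises the exponent to \<open>q - b + 1\<close>, and \<open>- s d/ds\<close> lowers it by one.
  The point \<open>s = t\<close> is excluded because \<open>log_power t (q - b + 1)\<close> need not be differentiable there.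
\<close>

lemma hadamard_deriv_log_power:
  assumes "0 < b" "b < 1" "b < q" "0 < s" "s \<noteq> t"
    and f: "\<And>z. 0 < z \<Longrightarrow> z \<noteq> t \<Longrightarrow> f z = log_power t q z"
  shows "\<forall>\<^sub>F u in nhds s. hadamard_integrable_at (1 - b) f u"
    and "hadamard_integral (1 - b) f differentiable at s"
    and "hadamard_deriv b f s = log_power t (q - b) s"
proof -
  have ev: "\<forall>\<^sub>F u in nhds s. u \<in> {0<..}"
    using assms by (intro eventually_nhds_in_open) auto
  show "\<forall>\<^sub>F u in nhds s. hadamard_integrable_at (1 - b) f u"
    using ev by eventually_elim (use assms in \<open>auto intro!: hadamard_integral_log_power(1)[where q = q]\<close>)
  have "\<forall>\<^sub>F u in nhds s. hadamard_integral (1 - b) f u = log_power t (q - b + 1) u"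
    using ev by eventually_elim
      (use hadamard_integral_log_power(2)[of "1 - b" q _ t f] assms in \<open>simp add: algebra_simps\<close>)
  then have D: "(hadamard_integral (1 - b) f has_real_derivative
      - log_power t (q - b) s / s) (at s)"
    using DERIV_log_power[of s t "q - b"] assms by (subst DERIV_cong_ev[OF refl _ refl]) auto
  then show "hadamard_integral (1 - b) f differentiable at s"
    using real_differentiable_def by blast
  show "hadamard_deriv b f s = log_power t (q - b) s"
    using DERIV_imp_deriv[OF D] assms by (simp add: hadamard_deriv_def)
qed

text \<open>
  Under \<open>z = t exp (- x)\<close> the square of \<open>log_power t q\<close> becomes a multiple of the integrand of
  \<open>Gamma (2 q - 1)\<close>, which converges for \<open>q > 1 / 2\<close>.
\<close>

lemma square_integrable_log_power:
  assumes "1 / 2 < q"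
    and f: "\<And>z. 0 < z \<Longrightarrow> z \<noteq> t \<Longrightarrow> f z = log_power t q z"
  shows "f \<in> L2_pos"
proof -
  define r where "r = 2 * q - 1"
  have r: "r > 0" using assms by (simp add: r_def)
  have meas: "log_power t q \<in> borel_measurable borel"
    unfolding log_power_def by measurable
  have meas': "log_power t q \<in> borel_measurable (lebesgue_on {0<..})"
    using meas by (intro measurable_restrict_space1) (simp add: measurable_completion)
  have "integrable (lebesgue_on {0<..}) (\<lambda>x. (log_power t q x)\<^sup>2)"
  proof (cases "0 < t")
    case False
    then have "log_power t q x = 0" for x by (auto simp: log_power_def)
    then show ?thesis by simp
  next
    case True
    define g where "g = (\<lambda>x. t * exp (- x))"
    have deriv: "(g has_field_derivative - g x) (at x within {0<..})" for x
      unfolding g_def by (auto intro!: derivative_eq_intros)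
    have inj: "inj_on g {0<..}" using True by (auto simp: inj_on_def g_def)
    have img: "g ` {0<..} = {0<..<t}"
    proof (intro set_eqI iffI)
      fix z assume "z \<in> {0<..<t}"
      then have "ln (t / z) \<in> {0<..}" "g (ln (t / z)) = z"
        using True by (auto simp: g_def exp_minus)
      then show "z \<in> g ` {0<..}" by (metis imageI)
    qed (use True in \<open>auto simp: g_def\<close>)
    have "((\<lambda>x. x powr (r - 1) / exp x) has_integral Gamma r) {0<..}"
      using Gamma_integral_real[OF r] by (rule has_integral_spike_set_eq[THEN iffD1, rotated -1])
        (auto intro: negligible_subset[of "{0}"])
    then have "(\<lambda>x. t * (x powr (r - 1) / exp x)) absolutely_integrable_on {0<..}"
      using True
      by (intro nonnegative_absolutely_integrable_1 integrable_on_mult_right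
          has_integral_integrable) auto
    moreover have "\<bar>- g x\<bar> * ln (t / g x) powr (r - 1) = t * (x powr (r - 1) / exp x)" for x
      using True by (simp add: g_def exp_minus field_simps)
    ultimately have "(\<lambda>z. ln (t / z) powr (r - 1)) absolutely_integrable_on {0<..<t}"
      using absolutely_integrable_change_of_variables_1'[OF _ deriv inj,
          where f = "\<lambda>z. ln (t / z) powr (r - 1)"]
      unfolding img by simp
    then have "integrable lebesgue (\<lambda>z. indicator {0<..<t} z *\<^sub>R ln (t / z) powr (r - 1) / (Gamma q)\<^sup>2)"
      unfolding set_integrable_def by (intro integrable_divide) simp
    also have "(\<lambda>z. indicator {0<..<t} z *\<^sub>R ln (t / z) powr (r - 1) / (Gamma q)\<^sup>2) =
        (\<lambda>z. indicator {0<..} z *\<^sub>R (log_power t q z)\<^sup>2)"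
    proof
      fix z
      have "(ln (t / z) powr (q - 1))\<^sup>2 = ln (t / z) powr (r - 1)"
        by (simp add: power2_eq_square powr_add[symmetric] r_def)
      then show "indicator {0<..<t} z *\<^sub>R ln (t / z) powr (r - 1) / (Gamma q)\<^sup>2 =
        indicator {0<..} z *\<^sub>R (log_power t q z)\<^sup>2"
        by (auto simp: indicator_def log_power_def power_divide)
    qed
    finally show ?thesis by (simp add: integrable_restrict_space)
  qed
  then have "integrable (lebesgue_on {0<..}) (\<lambda>x. (f x)\<^sup>2)"
    by (subst integrable_discrete_difference[where X = "{0<..} \<inter> {t}" and g = "\<lambda>x. (log_power t q x)\<^sup>2"])
      (auto simp: f sets_restrict_space_iff emeasure_restrict_space)
  moreover have "f \<in> borel_measurable (lebesgue_on {0<..})"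
    using meas' by (rule measurable_discrete_difference[where X = "{0<..} \<inter> {t}"])
      (auto simp: f sets_restrict_space_iff)
  ultimately show ?thesis by (simp add: L2_pos_def square_integrable_def)
qed


section \<open>Square-integrable functions and step functions\<close>

lemma square_integrable_mult:
  assumes "square_integrable N f" "square_integrable N g"
  shows "integrable N (\<lambda>x. f x * g x)"
proof (rule Bochner_Integration.integrable_bound)
  show "integrable N (\<lambda>x. (f x)\<^sup>2 + (g x)\<^sup>2)"
    using assms by (simp add: square_integrable_def)
  show "(\<lambda>x. f x * g x) \<in> borel_measurable N"
    using assms by (auto simp: square_integrable_def)
  have "\<bar>a * b\<bar> \<le> a\<^sup>2 + b\<^sup>2" for a b :: real
  proof -
    have "2 * (\<bar>a\<bar> * \<bar>b\<bar>) \<le> a\<^sup>2 + b\<^sup>2"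
      using sum_squares_bound[of "\<bar>a\<bar>" "\<bar>b\<bar>"] by (simp add: mult.assoc)
    moreover have "0 \<le> \<bar>a\<bar> * \<bar>b\<bar>" by simp
    ultimately show ?thesis unfolding abs_mult by linarith
  qed
  then show "AE x in N. norm (f x * g x) \<le> norm ((f x)\<^sup>2 + (g x)\<^sup>2)" by simp
qed

lemma square_integrable_scale:
  "square_integrable N f \<Longrightarrow> square_integrable N (\<lambda>x. c * f x)"
  by (auto simp: square_integrable_def power_mult_distrib)

lemma square_integrable_add:
  assumes "square_integrable N f" "square_integrable N g"
  shows "square_integrable N (\<lambda>x. f x + g x)"
  using assms square_integrable_mult[OF assms]
  by (auto simp: square_integrable_def power2_sum mult.assoc)

lemma square_integrable_diff:
  assumes "square_integrable N f" "square_integrable N g"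
  shows "square_integrable N (\<lambda>x. f x - g x)"
  using assms square_integrable_mult[OF assms]
  by (auto simp: square_integrable_def power2_diff mult.assoc)

lemma integral_power2_diff_le:
  assumes "square_integrable N f" "square_integrable N g"
  shows "(LINT x|N. (f x - g x)\<^sup>2) \<le> 2 * (LINT x|N. (f x)\<^sup>2) + 2 * (LINT x|N. (g x)\<^sup>2)"
proof -
  have "(LINT x|N. (f x - g x)\<^sup>2) \<le> (LINT x|N. 2 * (f x)\<^sup>2 + 2 * (g x)\<^sup>2)"
  proof (rule integral_mono)
    show "integrable N (\<lambda>x. (f x - g x)\<^sup>2)"
      using square_integrable_diff[OF assms] by (simp add: square_integrable_def)
    show "(f x - g x)\<^sup>2 \<le> 2 * (f x)\<^sup>2 + 2 * (g x)\<^sup>2" for x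
      using zero_le_power2[of "f x + g x"] by (simp add: power2_sum power2_diff)
  qed (use assms in \<open>simp add: square_integrable_def\<close>)
  then show ?thesis using assms by (simp add: square_integrable_def)
qed

lemma step_fun_Cons:
  "step_fun ((a, u, v) # xs) s = a * indicator {u..<v} s + step_fun xs s"
  by (simp add: step_fun_def)

lemma step_integral_Cons:
  "step_integral B ((a, u, v) # xs) \<omega> = a * (B v \<omega> - B u \<omega>) + step_integral B xs \<omega>"
  by (simp add: step_integral_def)

lemma step_Nil: "step_fun [] s = 0" "step_integral B [] \<omega> = 0"
  by (simp_all add: step_fun_def step_integral_def)

definition step_diff ::
    "(real \<times> real \<times> real) list \<Rightarrow> (real \<times> real \<times> real) list \<Rightarrow> (real \<times> real \<times> real) list" where
  "step_diff xs ys = xs @ map (\<lambda>(a, u, v). (- a, u, v)) ys"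

lemma valid_step_diff: "valid_step xs \<Longrightarrow> valid_step ys \<Longrightarrow> valid_step (step_diff xs ys)"
  by (auto simp: valid_step_def step_diff_def)

lemma step_fun_diff: "step_fun (step_diff xs ys) s = step_fun xs s - step_fun ys s"
  by (simp add: step_fun_def step_diff_def o_def split_def uminus_sum_list_map)

lemma step_integral_diff:
  "step_integral B (step_diff xs ys) \<omega> = step_integral B xs \<omega> - step_integral B ys \<omega>"
  by (simp add: step_integral_def step_diff_def o_def split_def uminus_sum_list_map)

lemma square_integrable_indicator_pos:
  fixes t :: real
  shows "square_integrable (lebesgue_on {0<..}) (indicator {0..<t})"
proof -
  have *: "{0..<t} \<inter> {0<..} = {0<..<t}" by auto
  have "integrable lebesgue (\<lambda>x. indicator ({0..<t} \<inter> {0<..}) x :: real)"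
    by (cases "0 \<le> t"; intro integrable_real_indicator) (simp_all add: *)
  moreover have "indicator ({0..<t} \<inter> {0<..}) x = indicator {0<..} x *\<^sub>R (indicator {0..<t} x :: real)\<^sup>2" for x
    by (auto simp: indicator_def)
  moreover have "(indicator {0..<t} :: real \<Rightarrow> real) \<in> borel_measurable lebesgue"
    by (intro borel_measurable_indicator) simp
  ultimately show ?thesis
    by (simp add: square_integrable_def integrable_restrict_space measurable_restrict_space1)
qed

text \<open>
  The inner product of indicators that matches the covariance of Brownian motion.
\<close>

lemma integral_indicator_mult_pos:
  fixes s t :: real
  assumes "0 \<le> s" "0 \<le> t"
  shows "(LINT x|lebesgue_on {0<..}. indicator {0..<s} x * indicator {0..<t} x) = min s t"
proof -
  have "indicator {0<..} x *\<^sub>R (indicator {0..<s} x * indicator {0..<t} x :: real)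
      = indicator {0<..<min s t} x" for x :: real
    by (auto simp: indicator_def)
  then have "(LINT x|lebesgue_on {0<..}. indicator {0..<s} x * indicator {0..<t} x) =
      (LINT x|lebesgue. indicator {0<..<min s t} x :: real)"
    by (subst integral_restrict_space) auto
  also have "\<dots> = min s t" using assms by simp
  finally show ?thesis .
qed

lemma indicator_interval_diff:
  fixes u v x :: real
  shows "0 \<le> u \<Longrightarrow> u \<le> v \<Longrightarrow>
    indicator {u..<v} x = (indicator {0..<v} x - indicator {0..<u} x :: real)"
  by (auto simp: indicator_def)

lemma square_integrable_step_fun:
  "valid_step xs \<Longrightarrow> square_integrable (lebesgue_on {0<..}) (step_fun xs)"
proof (induction xs)
  case Nil
  then show ?case by (simp add: square_integrable_def step_Nil[abs_def])
next
  case (Cons x xs)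
  obtain a u v where x: "x = (a, u, v)" by (cases x)
  have uv: "0 \<le> u" "u \<le> v" and xs: "valid_step xs"
    using Cons.prems by (auto simp: x valid_step_def)
  have "step_fun (x # xs) = (\<lambda>s. a * (indicator {0..<v} s - indicator {0..<u} s) + step_fun xs s)"
    by (rule ext) (simp add: x step_fun_Cons indicator_interval_diff[OF uv])
  with Cons.IH[OF xs] show ?case
    by (auto intro!: square_integrable_add square_integrable_scale square_integrable_diff
        square_integrable_indicator_pos)
qed

section \<open>Isometry and uniqueness of the Wiener integral\<close>

context standard_brownian_motion
begin

lemma increment_moments:
  assumes "0 \<le> s" "s \<le> t"
  shows "square_integrable M (\<lambda>\<omega>. B t \<omega> - B s \<omega>)"
    and "expectation (\<lambda>\<omega>. B t \<omega> - B s \<omega>) = 0"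
    and "expectation (\<lambda>\<omega>. (B t \<omega> - B s \<omega>)\<^sup>2) = t - s"
proof -
  have meas: "(\<lambda>\<omega>. B t \<omega> - B s \<omega>) \<in> borel_measurable M"
    using measurable_at assms by simp
  have "integrable M (\<lambda>\<omega>. (B t \<omega> - B s \<omega>)\<^sup>2) \<and> expectation (\<lambda>\<omega>. B t \<omega> - B s \<omega>) = 0 \<and>
      expectation (\<lambda>\<omega>. (B t \<omega> - B s \<omega>)\<^sup>2) = t - s"
  proof (cases "s = t")
    case False
    then have pos: "0 < sqrt (t - s)" and st: "s < t" using assms by auto
    note D = normal_increments[OF assms(1) st]
    have "integrable M (\<lambda>\<omega>. (B t \<omega> - B s \<omega>)\<^sup>2)"
      using distributed_integrable[OF D, of "\<lambda>x. x\<^sup>2"] integrable_normal_moment[OF pos, of 0 2]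
      by simp
    moreover have E: "expectation (\<lambda>\<omega>. B t \<omega> - B s \<omega>) = 0"
      by (rule normal_distributed_expectation[OF pos D])
    moreover have "expectation (\<lambda>\<omega>. (B t \<omega> - B s \<omega>)\<^sup>2) = t - s"
      using normal_distributed_variance[OF pos D] st unfolding E by simp
    ultimately show ?thesis by simp
  qed simp
  with meas show "square_integrable M (\<lambda>\<omega>. B t \<omega> - B s \<omega>)"
    and "expectation (\<lambda>\<omega>. B t \<omega> - B s \<omega>) = 0"
    and "expectation (\<lambda>\<omega>. (B t \<omega> - B s \<omega>)\<^sup>2) = t - s"
    by (auto simp: square_integrable_def)
qed

text \<open>
  Write \<open>B t - B 0 = (B s - B 0) + (B t - B s)\<close>: the two increments are independent and centred, so
  only the variance \<open>s\<close> of the first survives. The paths start at \<open>0\<close> only almost surely, which is why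
  \<open>B 0\<close> is subtracted.
\<close>

lemma expectation_increment_mult_le:
  assumes "0 \<le> s" "s \<le> t"
  shows "expectation (\<lambda>\<omega>. (B s \<omega> - B 0 \<omega>) * (B t \<omega> - B 0 \<omega>)) = s"
proof -
  let ?U = "\<lambda>\<omega>. B s \<omega> - B 0 \<omega>" and ?V = "\<lambda>\<omega>. B t \<omega> - B s \<omega>"
  note U = increment_moments[of 0 s] and V = increment_moments[of s t]
  have int: "integrable M (\<lambda>\<omega>. ?U \<omega> * ?V \<omega>)" "integrable M (\<lambda>\<omega>. (?U \<omega>)\<^sup>2)"
    using U V assms by (auto intro: square_integrable_mult simp: square_integrable_def)
  have "expectation (\<lambda>\<omega>. ?U \<omega> * ?V \<omega>) = 0"
  proof (cases "0 < s \<and> s < t")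
    case True
    \<comment> \<open>Values of \<open>\<tau>\<close> beyond index 2 do not enter the two increments.\<close>
    define \<tau> :: "nat \<Rightarrow> real" where "\<tau> = (\<lambda>i. if i = 0 then 0 else if i = 1 then s else t)"
    have ind: "indep_vars (\<lambda>_. borel) (\<lambda>i \<omega>. B (\<tau> (Suc i)) \<omega> - B (\<tau> i) \<omega>) {..<2}"
      using True by (intro indep_increments) (auto simp: \<tau>_def less_2_cases_iff)
    have L1: "integrable M ?U" "integrable M ?V"
      using U(1) V(1) assms square_integrable_imp_integrable unfolding square_integrable_def by blast+
    have "expectation (\<lambda>\<omega>. \<Prod>i<2. B (\<tau> (Suc i)) \<omega> - B (\<tau> i) \<omega>) =
        (\<Prod>i<2. expectation (\<lambda>\<omega>. B (\<tau> (Suc i)) \<omega> - B (\<tau> i) \<omega>))"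
      by (rule indep_vars_lebesgue_integral[OF _ ind])
        (use L1 in \<open>auto simp: \<tau>_def less_2_cases_iff\<close>)
    then show ?thesis using U(2) V(2) assms by (simp add: \<tau>_def numeral_2_eq_2)
  next
    case False
    then have "s = 0 \<or> s = t" using assms by auto
    then show ?thesis by auto
  qed
  moreover have "(\<lambda>\<omega>. ?U \<omega> * (B t \<omega> - B 0 \<omega>)) = (\<lambda>\<omega>. (?U \<omega>)\<^sup>2 + ?U \<omega> * ?V \<omega>)"
    by (auto simp: power2_eq_square algebra_simps)
  ultimately show ?thesis using int U(3) assms by simp
qed

lemma expectation_increment_mult:
  assumes "0 \<le> s" "0 \<le> t"
  shows "expectation (\<lambda>\<omega>. (B s \<omega> - B 0 \<omega>) * (B t \<omega> - B 0 \<omega>)) = min s t"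
  using expectation_increment_mult_le[of s t] expectation_increment_mult_le[of t s] assms
  by (cases "s \<le> t") (auto simp: mult.commute min_def)

lemma square_integrable_step_integral:
  "valid_step xs \<Longrightarrow> square_integrable M (step_integral B xs)"
proof (induction xs)
  case Nil
  then show ?case by (simp add: square_integrable_def step_Nil[abs_def])
next
  case (Cons x xs)
  obtain a u v where x: "x = (a, u, v)" by (cases x)
  have uv: "0 \<le> u" "u \<le> v" and xs: "valid_step xs"
    using Cons.prems by (auto simp: x valid_step_def)
  have "step_integral B (x # xs) = (\<lambda>\<omega>. a * (B v \<omega> - B u \<omega>) + step_integral B xs \<omega>)"
    by (rule ext) (simp add: x step_integral_Cons)
  with Cons.IH[OF xs] increment_moments(1)[OF uv] show ?case
    by (auto intro!: square_integrable_add square_integrable_scale)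
qed

text \<open>
  Both sides are linear in the step function, so it suffices to pair the indicators of \<open>[0, t)\<close> with a
  fixed partner \<open>(G, g)\<close>. Keeping the partner abstract lets the lemma be used once in each argument of
  the inner product.
\<close>

lemma step_isometry_aux:
  assumes G: "square_integrable M G" and g: "square_integrable (lebesgue_on {0<..}) g"
    and base: "\<And>t. 0 \<le> t \<Longrightarrow> expectation (\<lambda>\<omega>. (B t \<omega> - B 0 \<omega>) * G \<omega>) =
      (LINT x|lebesgue_on {0<..}. indicator {0..<t} x * g x)"
    and "valid_step xs"
  shows "expectation (\<lambda>\<omega>. step_integral B xs \<omega> * G \<omega>) =
    (LINT x|lebesgue_on {0<..}. step_fun xs x * g x)"
  using \<open>valid_step xs\<close>
proof (induction xs)
  case Nil
  then show ?case by (simp add: step_Nil)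
next
  case (Cons x xs)
  obtain a u v where x: "x = (a, u, v)" by (cases x)
  have uv: "0 \<le> u" "u \<le> v" "0 \<le> v" and xs: "valid_step xs"
    using Cons.prems by (auto simp: x valid_step_def)
  have W: "integrable M (\<lambda>\<omega>. (B t \<omega> - B 0 \<omega>) * G \<omega>)" if "0 \<le> t" for t
    using increment_moments(1)[of 0 t] that G by (intro square_integrable_mult) auto
  have S: "integrable M (\<lambda>\<omega>. step_integral B xs \<omega> * G \<omega>)"
    using square_integrable_step_integral[OF xs] G by (rule square_integrable_mult)
  have w: "integrable (lebesgue_on {0<..}) (\<lambda>x. indicator {0..<t} x * g x)" for t
    using square_integrable_indicator_pos g by (rule square_integrable_mult)
  have s: "integrable (lebesgue_on {0<..}) (\<lambda>y. step_fun xs y * g y)"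
    using square_integrable_step_fun[OF xs] g by (rule square_integrable_mult)
  have "(\<lambda>\<omega>. step_integral B (x # xs) \<omega> * G \<omega>) =
      (\<lambda>\<omega>. a * ((B v \<omega> - B 0 \<omega>) * G \<omega> - (B u \<omega> - B 0 \<omega>) * G \<omega>) + step_integral B xs \<omega> * G \<omega>)"
    by (auto simp: x step_integral_Cons algebra_simps)
  moreover have "(\<lambda>y. step_fun (x # xs) y * g y) =
      (\<lambda>y. a * (indicator {0..<v} y * g y - indicator {0..<u} y * g y) + step_fun xs y * g y)"
    by (auto simp: x step_fun_Cons indicator_interval_diff[OF uv(1,2)] algebra_simps)
  ultimately show ?case
    using W[OF uv(1)] W[OF uv(3)] S w s base[OF uv(1)] base[OF uv(3)] Cons.IH[OF xs] by simp
qed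

lemma step_isometry:
  assumes "valid_step xs"
  shows "expectation (\<lambda>\<omega>. (step_integral B xs \<omega>)\<^sup>2) =
    (LINT x|lebesgue_on {0<..}. (step_fun xs x)\<^sup>2)"
proof -
  have "expectation (\<lambda>\<omega>. (B t \<omega> - B 0 \<omega>) * step_integral B xs \<omega>) =
      (LINT x|lebesgue_on {0<..}. indicator {0..<t} x * step_fun xs x)" if t: "0 \<le> t" for t
  proof -
    have "expectation (\<lambda>\<omega>. step_integral B xs \<omega> * (B t \<omega> - B 0 \<omega>)) =
      (LINT x|lebesgue_on {0<..}. step_fun xs x * indicator {0..<t} x)"
      using increment_moments(1)[of 0 t] t assms
      by (intro step_isometry_aux square_integrable_indicator_pos)
        (simp_all add: expectation_increment_mult integral_indicator_mult_pos)
    then show ?thesis by (simp add: mult.commute)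
  qed
  from step_isometry_aux[OF square_integrable_step_integral square_integrable_step_fun this]
  show ?thesis using assms by (simp add: power2_eq_square)
qed

text \<open>
  Two approximating sequences \<open>\<phi>\<close> and \<open>\<psi>\<close> of \<open>f\<close> approach each other in \<open>L\<^sub>2\<close>, hence by the isometry so do
  their integrals, and therefore the limits \<open>X\<close> and \<open>Y\<close> of these coincide.
\<close>

lemma has_wiener_integral_unique:
  assumes X: "has_wiener_integral M B f X" and Y: "has_wiener_integral M B f Y"
  shows "AE \<omega> in M. X \<omega> = Y \<omega>"
proof -
  let ?L = "lebesgue_on {0<..} :: real measure"
  obtain \<phi> where \<phi>: "\<And>n. valid_step (\<phi> n)"
      "(\<lambda>n. LINT s|?L. (step_fun (\<phi> n) s - f s)\<^sup>2) \<longlonglongrightarrow> 0"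
      "(\<lambda>n. LINT \<omega>|M. (step_integral B (\<phi> n) \<omega> - X \<omega>)\<^sup>2) \<longlonglongrightarrow> 0"
    using X unfolding has_wiener_integral_def by blast
  obtain \<psi> where \<psi>: "\<And>n. valid_step (\<psi> n)"
      "(\<lambda>n. LINT s|?L. (step_fun (\<psi> n) s - f s)\<^sup>2) \<longlonglongrightarrow> 0"
      "(\<lambda>n. LINT \<omega>|M. (step_integral B (\<psi> n) \<omega> - Y \<omega>)\<^sup>2) \<longlonglongrightarrow> 0"
    using Y unfolding has_wiener_integral_def by blast
  have sq: "square_integrable ?L f" "square_integrable M X" "square_integrable M Y"
    using X Y by (auto simp: has_wiener_integral_def L2_pos_def)
  note sqd = square_integrable_diff square_integrable_step_fun square_integrable_step_integral
  have D: "(LINT \<omega>|M. (step_integral B (\<phi> n) \<omega> - step_integral B (\<psi> n) \<omega>)\<^sup>2) \<le>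
      2 * (LINT s|?L. (step_fun (\<phi> n) s - f s)\<^sup>2) + 2 * (LINT s|?L. (step_fun (\<psi> n) s - f s)\<^sup>2)" for n
  proof -
    have "(LINT \<omega>|M. (step_integral B (\<phi> n) \<omega> - step_integral B (\<psi> n) \<omega>)\<^sup>2) =
        (LINT s|?L. ((step_fun (\<phi> n) s - f s) - (step_fun (\<psi> n) s - f s))\<^sup>2)"
      using step_isometry[OF valid_step_diff[OF \<phi>(1)[of n] \<psi>(1)[of n]]]
      by (simp add: step_fun_diff step_integral_diff)
    also have "\<dots> \<le> 2 * (LINT s|?L. (step_fun (\<phi> n) s - f s)\<^sup>2) +
        2 * (LINT s|?L. (step_fun (\<psi> n) s - f s)\<^sup>2)"
      by (intro integral_power2_diff_le sqd sq \<phi> \<psi>)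
    finally show ?thesis .
  qed
  let ?b = "\<lambda>n. 2 * (2 * (LINT s|?L. (step_fun (\<phi> n) s - f s)\<^sup>2) + 2 * (LINT s|?L. (step_fun (\<psi> n) s - f s)\<^sup>2)) +
      2 * (2 * (LINT \<omega>|M. (step_integral B (\<phi> n) \<omega> - X \<omega>)\<^sup>2) +
           2 * (LINT \<omega>|M. (step_integral B (\<psi> n) \<omega> - Y \<omega>)\<^sup>2))"
  have "(LINT \<omega>|M. (X \<omega> - Y \<omega>)\<^sup>2) \<le> ?b n" for n
  proof -
    have "(LINT \<omega>|M. (X \<omega> - Y \<omega>)\<^sup>2) = (LINT \<omega>|M. ((step_integral B (\<phi> n) \<omega> - step_integral B (\<psi> n) \<omega>) -
        ((step_integral B (\<phi> n) \<omega> - X \<omega>) - (step_integral B (\<psi> n) \<omega> - Y \<omega>)))\<^sup>2)"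
      by simp
    also have "\<dots> \<le> 2 * (LINT \<omega>|M. (step_integral B (\<phi> n) \<omega> - step_integral B (\<psi> n) \<omega>)\<^sup>2) +
        2 * (LINT \<omega>|M. ((step_integral B (\<phi> n) \<omega> - X \<omega>) - (step_integral B (\<psi> n) \<omega> - Y \<omega>))\<^sup>2)"
      by (intro integral_power2_diff_le sqd sq \<phi> \<psi>)
    also have "(LINT \<omega>|M. ((step_integral B (\<phi> n) \<omega> - X \<omega>) - (step_integral B (\<psi> n) \<omega> - Y \<omega>))\<^sup>2) \<le>
        2 * (LINT \<omega>|M. (step_integral B (\<phi> n) \<omega> - X \<omega>)\<^sup>2) +
        2 * (LINT \<omega>|M. (step_integral B (\<psi> n) \<omega> - Y \<omega>)\<^sup>2)"
      by (intro integral_power2_diff_le sqd sq \<phi> \<psi>)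
    finally show ?thesis using D[of n] by simp
  qed
  moreover have "?b \<longlonglongrightarrow> 2 * (2 * 0 + 2 * 0) + 2 * (2 * 0 + 2 * 0)"
    by (intro tendsto_intros \<phi> \<psi>)
  ultimately have "(LINT \<omega>|M. (X \<omega> - Y \<omega>)\<^sup>2) \<le> 0"
    using LIMSEQ_le_const[of ?b] by simp
  then have "(LINT \<omega>|M. (X \<omega> - Y \<omega>)\<^sup>2) = 0"
    by (intro antisym Bochner_Integration.integral_nonneg) auto
  moreover have "integrable M (\<lambda>\<omega>. (X \<omega> - Y \<omega>)\<^sup>2)"
    using square_integrable_diff[OF sq(2,3)] by (simp add: square_integrable_def)
  ultimately have "AE \<omega> in M. (X \<omega> - Y \<omega>)\<^sup>2 = 0"
    by (subst (asm) integral_nonneg_eq_0_iff_AE) auto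
  then show ?thesis by eventually_elim simp
qed

text \<open>
  The constant sequence \<open>xs\<close> already approximates \<open>f\<close>, so \<open>step_integral B xs\<close> is one version of the
  integral; by uniqueness the chosen version agrees with it.
\<close>

lemma wiener_integral_step:
  assumes "f \<in> L2_pos" "valid_step xs"
    and "AE s in lebesgue_on {0<..}. f s = step_fun xs s"
  shows "AE \<omega> in M. wiener_integral M B f \<omega> = step_integral B xs \<omega>"
proof -
  have "(LINT s|lebesgue_on {0<..}. (step_fun xs s - f s)\<^sup>2) = 0"
    using assms(3) by (intro integral_eq_zero_AE) (auto elim!: eventually_mono)
  then have step: "has_wiener_integral M B f (step_integral B xs)"
    unfolding has_wiener_integral_def
    using assms square_integrable_step_integral by (intro conjI exI[of _ "\<lambda>_. xs"]) auto
  then have "has_wiener_integral M B f (wiener_integral M B f)"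
    unfolding wiener_integral_def by (rule someI[where P = "has_wiener_integral M B f"])
  then show ?thesis using step by (rule has_wiener_integral_unique)
qed

end

section \<open>The inverse operator on indicators\<close>

lemma AE_pos_off_point:
  assumes "\<And>s. 0 < s \<Longrightarrow> s \<noteq> c \<Longrightarrow> P s"
  shows "AE s in lebesgue_on {0<..}. P (s :: real)"
proof -
  have "AE s in lebesgue. s \<noteq> c"
    by (rule AE_I'[of "{c}"]) auto
  then show ?thesis
    using assms by (subst AE_restrict_space_iff) (auto elim!: eventually_mono)
qed

lemma indicator_eq_log_power:
  "0 < z \<Longrightarrow> indicator {0..<t} z = log_power t 1 z"
  by (auto simp: indicator_def log_power_def)

text \<open>
  The two operators shift the exponent of \<open>log_power\<close> by opposite amounts, from \<open>1\<close> (the indicator)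
  to \<open>(3 - \<alpha>) / 2 > 1 / 2\<close> and back to \<open>1\<close>. For \<open>\<alpha> < 1\<close> this is an integral followed by a
  derivative, for \<open>\<alpha> > 1\<close> a derivative followed by an integral.
\<close>

lemma hadamard_M_Mbar_indicator:
  fixes \<alpha> t :: real
  assumes "\<alpha> \<in> {0<..<1} \<union> {1<..<2}"
  defines "g \<equiv> hadamard_Mbar \<alpha> (indicator {0..<t})"
  shows "hadamard_Mbar_defined \<alpha> (indicator {0..<t})"
    and "g \<in> L2_pos"
    and "hadamard_M_defined \<alpha> g"
    and "\<And>s. 0 < s \<Longrightarrow> s \<noteq> t \<Longrightarrow> hadamard_M \<alpha> g s = hadamard_K \<alpha> * log_power t 1 s"
    and "hadamard_M \<alpha> g \<in> L2_pos"
proof -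
  have "hadamard_Mbar_defined \<alpha> (indicator {0..<t}) \<and> g \<in> L2_pos \<and> hadamard_M_defined \<alpha> g \<and>
    (\<exists>h. hadamard_M \<alpha> g = (\<lambda>s. hadamard_K \<alpha> * h s) \<and>
         (\<forall>s. 0 < s \<longrightarrow> s \<noteq> t \<longrightarrow> h s = log_power t 1 s))"
  proof (cases "\<alpha> < 1")
    case True
    define b where "b = (1 - \<alpha>) / 2"
    have b: "0 < b" "b < 1" using True assms by (auto simp: b_def)
    have g_def: "g = hadamard_integral b (indicator {0..<t})"
      using True by (simp add: g_def hadamard_Mbar_def b_def)
    have I: "hadamard_integrable_at b (indicator {0..<t}) s" "g s = log_power t (1 + b) s"
      if "0 < s" for s
      using hadamard_integral_log_power[OF b(1) _ that, of 1 t "indicator {0..<t}"]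
        indicator_eq_log_power by (auto simp: g_def add.commute)
    have D: "\<forall>\<^sub>F u in nhds s. hadamard_integrable_at (1 - b) g u"
        "hadamard_integral (1 - b) g differentiable at s"
        "hadamard_deriv b g s = log_power t 1 s" if "0 < s" "s \<noteq> t" for s
      using hadamard_deriv_log_power[OF b _ that, of "1 + b" g] I(2) by auto
    have "hadamard_Mbar_defined \<alpha> (indicator {0..<t})"
      using True I(1) by (auto simp: hadamard_Mbar_defined_def hadamard_integral_defined_def b_def
          intro!: AE_pos_off_point)
    moreover have "g \<in> L2_pos" using b I(2) by (intro square_integrable_log_power[of "1 + b"]) auto
    moreover have "hadamard_M_defined \<alpha> g"
      using True D(1,2) by (auto simp: hadamard_M_defined_def hadamard_deriv_defined_def b_def
          intro!: AE_pos_off_point[of t])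
    moreover have "hadamard_M \<alpha> g = (\<lambda>s. hadamard_K \<alpha> * hadamard_deriv b g s)"
      using True by (simp add: hadamard_M_def b_def)
    ultimately show ?thesis using D(3) by blast
  next
    case False
    define b where "b = (\<alpha> - 1) / 2"
    have b: "0 < b" "b < 1" "b < 1 / 2" and \<alpha>: "\<not> \<alpha> < 1" "\<alpha> \<noteq> 1"
      using False assms by (auto simp: b_def)
    have g_def: "g = hadamard_deriv b (indicator {0..<t})"
      using \<alpha> by (simp add: g_def hadamard_Mbar_def b_def)
    have D: "\<forall>\<^sub>F u in nhds s. hadamard_integrable_at (1 - b) (indicator {0..<t}) u"
        "hadamard_integral (1 - b) (indicator {0..<t}) differentiable at s"
        "g s = log_power t (1 - b) s" if "0 < s" "s \<noteq> t" for s
      using hadamard_deriv_log_power[OF b(1,2) _ that, of 1 "indicator {0..<t}"]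
        indicator_eq_log_power b by (auto simp: g_def)
    have I: "hadamard_integrable_at b g s" "hadamard_integral b g s = log_power t 1 s"
      if "0 < s" for s
      using hadamard_integral_log_power[OF b(1) _ that, of "1 - b" t g] D(3) b by auto
    have "hadamard_Mbar_defined \<alpha> (indicator {0..<t})"
      using \<alpha> D(1,2) by (auto simp: hadamard_Mbar_defined_def hadamard_deriv_defined_def b_def
          intro!: AE_pos_off_point[of t])
    moreover have "g \<in> L2_pos" using b D(3) by (intro square_integrable_log_power[of "1 - b"]) auto
    moreover have "hadamard_M_defined \<alpha> g"
      using \<alpha> I(1) by (auto simp: hadamard_M_defined_def hadamard_integral_defined_def b_def
          intro!: AE_pos_off_point)
    moreover have "hadamard_M \<alpha> g = (\<lambda>s. hadamard_K \<alpha> * hadamard_integral b g s)"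
      using \<alpha> by (simp add: hadamard_M_def b_def)
    ultimately show ?thesis using I(2) by blast
  qed
  then obtain h where *: "hadamard_Mbar_defined \<alpha> (indicator {0..<t})" "g \<in> L2_pos"
      "hadamard_M_defined \<alpha> g" "hadamard_M \<alpha> g = (\<lambda>s. hadamard_K \<alpha> * h s)"
      "\<And>s. 0 < s \<Longrightarrow> s \<noteq> t \<Longrightarrow> h s = log_power t 1 s" by blast
  have "h \<in> L2_pos" using *(5) by (intro square_integrable_log_power[of 1]) auto
  then have "hadamard_M \<alpha> g \<in> L2_pos" by (simp add: *(4) L2_pos_def square_integrable_scale)
  with * show "hadamard_Mbar_defined \<alpha> (indicator {0..<t})" "g \<in> L2_pos"
    "hadamard_M_defined \<alpha> g" "hadamard_M \<alpha> g \<in> L2_pos"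
    "\<And>s. 0 < s \<Longrightarrow> s \<noteq> t \<Longrightarrow> hadamard_M \<alpha> g s = hadamard_K \<alpha> * log_power t 1 s" by auto
qed

theorem theorem7p3:
  fixes M :: "'a measure" and B :: "real \<Rightarrow> 'a \<Rightarrow> real" and \<alpha> t :: real
  assumes "standard_brownian_motion M B"
    and "\<alpha> \<in> {0<..<1} \<union> {1<..<2}"
    and "t \<ge> 0"
  shows "hadamard_Mbar_defined \<alpha> (indicator {0..<t})
    \<and> hadamard_Mbar \<alpha> (indicator {0..<t}) \<in> L2_pos
    \<and> hadamard_Mbar \<alpha> (indicator {0..<t}) \<in> L2_hadamard \<alpha>
    \<and> (AE \<omega> in M. B t \<omega> = sqrt (Gamma \<alpha>) / Gamma ((\<alpha> + 1) / 2) *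
         hadamard_fbm_integral M B \<alpha> (hadamard_Mbar \<alpha> (indicator {0..<t})) \<omega>)"
proof -
  interpret standard_brownian_motion M B by fact
  let ?g = "hadamard_Mbar \<alpha> (indicator {0..<t})" and ?K = "hadamard_K \<alpha>"
  note g = hadamard_M_Mbar_indicator[OF assms(2), where t = t]
  \<comment> \<open>Off \<open>t\<close> the image is a one-interval step function, whose integral is \<open>?K * (B t - B 0)\<close>.\<close>
  have step: "hadamard_M \<alpha> ?g s = step_fun [(?K, 0, t)] s" if "0 < s" "s \<noteq> t" for s
    using g(4)[OF that] that by (simp add: step_fun_Cons step_Nil indicator_eq_log_power)
  have "AE \<omega> in M. wiener_integral M B (hadamard_M \<alpha> ?g) \<omega> = step_integral B [(?K, 0, t)] \<omega>"
    using assms(3) step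
    by (intro wiener_integral_step g(5) AE_pos_off_point[of t]) (auto simp: valid_step_def)
  then have "AE \<omega> in M. B t \<omega> = sqrt (Gamma \<alpha>) / Gamma ((\<alpha> + 1) / 2) *
      hadamard_fbm_integral M B \<alpha> ?g \<omega>"
    using starts_at_0
  proof eventually_elim
    case (elim \<omega>)
    have "Gamma \<alpha> > 0" "Gamma ((\<alpha> + 1) / 2) > 0"
      using assms(2) by (auto intro!: Gamma_real_pos)
    with elim show ?case
      by (simp add: hadamard_fbm_integral_def step_integral_Cons step_Nil hadamard_K_def)
  qed
  with g show ?thesis by (simp add: L2_hadamard_def)
qed

end
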